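(* Let $f\colon\mathbb R^n\to\mathbb R$ and $F\colon\mathbb R^n\to\mathbb R^m$ be twice continuously differentiable, let $D_1,\ldots,D_r\subset\mathbb R^m$ be polyhedral sets, $D:=\bigcup_{i=1}^r D_i$, and $X:=\{x\in\mathbb R^n\,|\,F(x)\in D\}$. Let $\bar x\in X$ be a locally optimal solution of the problem of minimizing $f(x)$ subject to $F(x)\in D$, and suppose that MPDC-LICQ is valid at $\bar x$. Then there exists a uniquely determined multiplier $\lambda\in\mathbb R^m$ such that \[ 0=\nabla f(\bar x)+\nabla F(\bar x)^\top\lambda,\qquad \lambda\in\bigcap_{i\in I(\bar x)}\widehat{\mathcal N}_{D_i}(F(\bar x)). \]
   Context: A set is polyhedral if it is the intersection of finitely many (closed) half spaces. $\nabla F(x)\in\mathbb R^{m\times n}$ denotes the Jacobian, $\nabla f(x)$ the gradient (a column vector). For a closed set $A\subset\mathbb R^m$ and $y\in A$, the tangent (Bouligand) cone is $\mathcal T_A(y):=\{d\,|\,\exists t_k\downarrow 0,\ \exists d_k\to d:\ y+t_kd_k\in A\ \forall k\}$, and the Fréchet (regular) normal cone is the polar cone $\widehat{\mathcal N}_A(y):=\mathcal T_A(y)^\circ=\{\eta\,|\,\eta\cdot d\le 0\ \forall d\in\mathcal T_A(y)\}$. For $\bar x\in X$, $I(\bar x):=\{i\in\{1,\ldots,r\}\,|\,F(\bar x)\in D_i\}$. MPDC-LICQ is said to hold at $\bar x\in X$ if the only vector $\lambda\in\sum_{i\in I(\bar x)}\operatorname{span}\widehat{\mathcal N}_{D_i}(F(\bar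 x))$ with $\nabla F(\bar x)^\top\lambda=0$ is $\lambda=0$. *)

theory Defs
  imports "HOL-Analysis.Analysis" "HOL-Library.Set_Algebras"
begin

(* The second derivative at x is a bounded linear map into the space of bounded linear maps;
   differentiability of f' is in the operator norm. *)
definition twice_continuously_differentiable ::
    "('a::real_normed_vector \<Rightarrow> 'b::real_normed_vector) \<Rightarrow> bool" where
  "twice_continuously_differentiable f \<longleftrightarrow>
     (\<exists>(f' :: 'a \<Rightarrow> 'a \<Rightarrow>\<^sub>L 'b) (f'' :: 'a \<Rightarrow> 'a \<Rightarrow>\<^sub>L 'a \<Rightarrow>\<^sub>L 'b).
        (\<forall>x. (f has_derivative blinfun_apply (f' x)) (at x)) \<and>
        (\<forall>x. (f' has_derivative blinfun_apply (f'' x)) (at x)) \<and>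
        continuous_on UNIV f'')"

(* Meaningful only where f is differentiable. *)
definition gradient :: "('a::real_inner \<Rightarrow> real) \<Rightarrow> 'a \<Rightarrow> 'a" where
  "gradient f x = (THE g. GDERIV f x :> g)"

(* "t_k decreases to 0" has its usual meaning in variational analysis: t_k > 0 and t_k tends
   to 0, not necessarily monotonically. *)
definition tangent_cone :: "'a::real_normed_vector set \<Rightarrow> 'a \<Rightarrow> 'a set" where
  "tangent_cone A y =
     {d. \<exists>(t :: nat \<Rightarrow> real) (e :: nat \<Rightarrow> 'a).
           (\<forall>k. t k > 0) \<and> t \<longlonglongrightarrow> 0 \<and> e \<longlonglongrightarrow> d \<and> (\<forall>k. y + t k *\<^sub>R e k \<in> A)}"

definition polar_cone :: "'a::real_inner set \<Rightarrow> 'a set" where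
  "polar_cone K = {\<eta>. \<forall>d\<in>K. \<eta> \<bullet> d \<le> 0}"

definition frechet_normal_cone :: "'a::real_inner set \<Rightarrow> 'a \<Rightarrow> 'a set" where
  "frechet_normal_cone A y = polar_cone (tangent_cone A y)"

definition feasible_set :: "('a \<Rightarrow> 'b) \<Rightarrow> (nat \<Rightarrow> 'b set) \<Rightarrow> nat \<Rightarrow> 'a set" where
  "feasible_set F D r = {x. F x \<in> (\<Union>i\<in>{1..r}. D i)}"

definition active_indices :: "('a \<Rightarrow> 'b) \<Rightarrow> (nat \<Rightarrow> 'b set) \<Rightarrow> nat \<Rightarrow> 'a \<Rightarrow> nat set" where
  "active_indices F D r x = {i\<in>{1..r}. F x \<in> D i}"

definition locally_optimal :: "('a::metric_space \<Rightarrow> real) \<Rightarrow> 'a set \<Rightarrow> 'a \<Rightarrow> bool" where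
  "locally_optimal f X x \<longleftrightarrow> x \<in> X \<and> (\<exists>\<epsilon>>0. \<forall>y\<in>X \<inter> ball x \<epsilon>. f x \<le> f y)"

(* The sum over the active indices is the Minkowski sum of sets. *)
definition MPDC_LICQ ::
    "(real^'n \<Rightarrow> real^'m) \<Rightarrow> (nat \<Rightarrow> (real^'m) set) \<Rightarrow> nat \<Rightarrow> real^'n \<Rightarrow> bool" where
  "MPDC_LICQ F D r x \<longleftrightarrow>
     (\<forall>lam. lam \<in> (\<Sum>i\<in>active_indices F D r x. span (frechet_normal_cone (D i) (F x))) \<longrightarrow>
           transpose (jacobian F (at x)) *v lam = 0 \<longrightarrow> lam = 0)"

end

theory Submission
  imports Defs
begin

text \<open>LICQ says that the adjoint of the Jacobian \<open>A\<close> is injective on the sum \<open>L\<close> of the spans of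
  the active normal cones. Hence every linearized direction \<open>v\<close> is attained by feasible points: by
  Brouwer's theorem the points \<open>x + t v\<close> can be moved by \<open>o(t)\<close> so that \<open>F\<close> agrees with
  \<open>F x + t A v\<close> up to a vector orthogonal to \<open>L\<close>, and such a vector does not affect the active
  constraints of any branch \<open>D\<^sub>i\<close>. So \<open>x\<close> is a linearized stationary point of every active branch,
  and Farkas' lemma gives a multiplier in each normal cone. The differences of these multipliers lie
  in \<open>L\<close> and in the kernel of the adjoint, so they are all equal.\<close>

section \<open>Farkas' lemma and linear algebra relative to a subspace\<close>

text \<open>A finitely generated cone is closed, so a point outside it is strictly separated from it
  by a hyperplane with normal \<open>a\<close>. As the cone can be scaled, \<open>a\<close> is
  nonnegative on \<open>S\<close>; then \<open>- a\<close> is an admissible \<open>v\<close> with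
  \<open>c \<bullet> v > 0\<close>.\<close>

lemma farkas_convex_cone_hull:
  fixes S :: "'a::euclidean_space set"
  assumes "finite S" and "\<And>v. (\<And>s. s \<in> S \<Longrightarrow> s \<bullet> v \<le> 0) \<Longrightarrow> c \<bullet> v \<le> 0"
  shows "c \<in> convex_cone hull S"
proof (rule ccontr)
  let ?K = "convex_cone hull S"
  assume "c \<notin> ?K"
  then obtain a b where c: "a \<bullet> c < b" and b: "\<And>x. x \<in> ?K \<Longrightarrow> b < a \<bullet> x"
    using separating_hyperplane_closed_point[of ?K c] assms(1)
    by (meson closed_convex_cone_hull convex_convex_cone_hull)
  have "b < 0"
    using b[OF convex_cone_hull_contains_0] by simp
  have "0 \<le> a \<bullet> s" if "s \<in> S" for s
  proof (rule ccontr)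
    assume neg: "\<not> 0 \<le> a \<bullet> s"
    \<comment> \<open>Both \<open>b\<close> and \<open>a \<bullet> s\<close> are negative, so the
      factor is positive. It scales \<open>s\<close> onto the hyperplane itself, where the strict
      bound on the cone fails.\<close>
    have "(b / (a \<bullet> s)) *\<^sub>R s \<in> ?K"
      using that neg \<open>b < 0\<close>
      by (intro convex_cone_hull_mul hull_inc) (auto simp: divide_nonpos_neg)
    with b neg show False by fastforce
  qed
  then have "c \<bullet> (- a) \<le> 0"
    by (intro assms(2)) (simp add: inner_commute)
  with c \<open>b < 0\<close> show False by (simp add: inner_commute)
qed

text \<open>\<open>P\<close> is the orthogonal projection onto \<open>L\<close>, written in an
  orthonormal basis. The inner product identity is checked on the basis and extends to
  \<open>L\<close> because the vectors \<open>l\<close> satisfying it form a subspace.\<close>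

lemma subspace_projection_exists:
  fixes L :: "'a::euclidean_space set"
  assumes "subspace L"
  obtains P where "linear P" and "\<And>y. P y \<in> L" and "\<And>y l. l \<in> L \<Longrightarrow> l \<bullet> P y = l \<bullet> y"
proof -
  obtain B where B: "B \<subseteq> L" "pairwise orthogonal B" "\<And>x. x \<in> B \<Longrightarrow> norm x = 1"
      "independent B" "span B = L"
    using orthonormal_basis_subspace[OF assms] by metis
  have "finite B" using B(4) by (rule independent_imp_finite)
  define P where "P y = (\<Sum>b\<in>B. (y \<bullet> b) *\<^sub>R b)" for y
  show thesis
  proof
    show "linear P"
      unfolding P_def by (rule linearI)
        (simp_all add: inner_left_distrib scaleR_left_distrib sum.distrib scaleR_sum_right)
    show "P y \<in> L" for y
      unfolding P_def using B(1) assms by (auto intro!: subspace_sum subspace_scale)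
    show "l \<bullet> P y = l \<bullet> y" if "l \<in> L" for l y
    proof -
      have "b \<bullet> P y = b \<bullet> y" if "b \<in> B" for b
      proof -
        have "b \<bullet> P y = (\<Sum>c\<in>B. (y \<bullet> c) * (b \<bullet> c))"
          by (simp add: P_def inner_sum_right)
        also have "\<dots> = (\<Sum>c\<in>B. if c = b then y \<bullet> b else 0)"
          using B(2,3) that by (intro sum.cong)
            (auto simp: pairwise_def orthogonal_def dot_square_norm)
        also have "\<dots> = b \<bullet> y"
          using that \<open>finite B\<close> by (simp add: inner_commute)
        finally show ?thesis .
      qed
      then have "B \<subseteq> {l. l \<bullet> (P y - y) = 0}" by (auto simp: inner_diff_right)
      moreover have "subspace {l. l \<bullet> (P y - y) = 0}"
        by (auto simp: subspace_def inner_left_distrib)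
      ultimately have "L \<subseteq> {l. l \<bullet> (P y - y) = 0}"
        using span_minimal B(5) by metis
      then show ?thesis using that by (auto simp: inner_diff_right)
    qed
  qed
qed

text \<open>Dualizing a left inverse \<open>g\<close> of \<open>adjoint A\<close> on
  \<open>L\<close> gives \<open>B = adjoint g\<close>: \<open>A\<close> after \<open>B\<close> is
  the identity up to vectors orthogonal to \<open>L\<close>.\<close>

lemma adjoint_injective_right_inverse:
  fixes A :: "'a::euclidean_space \<Rightarrow> 'b::euclidean_space"
  assumes "linear A" "subspace L" and "\<And>l. l \<in> L \<Longrightarrow> adjoint A l = 0 \<Longrightarrow> l = 0"
  obtains B where "linear B" and "\<And>y l. l \<in> L \<Longrightarrow> l \<bullet> A (B y) = l \<bullet> y"
proof -
  have lin: "linear (adjoint A)" using assms(1) by (rule adjoint_linear)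
  have "inj_on (adjoint A) L"
    unfolding linear_inj_on_iff_eq_0[OF lin assms(2)] using assms(3) by blast
  then obtain g where g: "linear g" "\<And>l. l \<in> L \<Longrightarrow> g (adjoint A l) = l"
    using linear_exists_left_inverse_on[OF lin assms(2)] by blast
  show thesis
  proof
    show "linear (adjoint g)" using g(1) by (rule adjoint_linear)
    show "l \<bullet> A (adjoint g y) = l \<bullet> y" if "l \<in> L" for y l
    proof -
      have "l \<bullet> A (adjoint g y) = adjoint g y \<bullet> adjoint A l"
        using adjoint_works[OF assms(1), of "adjoint g y" l] by (simp add: inner_commute)
      also have "\<dots> = l \<bullet> y"
        using adjoint_works[OF g(1), of "adjoint A l" y] g(2)[OF that] by (simp add: inner_commute)
      finally show ?thesis .
    qed
  qed
qed

section \<open>Corrected curves and first-order conditions along sequences\<close>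

text \<open>With the ansatz \<open>w = v + B z\<close>, the equation tested on \<open>L\<close>
  becomes a fixed point problem for \<open>z\<close>, driven by the remainder of the linearization
  divided by \<open>t\<close>. For small \<open>t\<close> this remainder is small enough to map a
  ball into itself, and Brouwer's theorem applies.\<close>

lemma curve_correction:
  fixes F :: "'a::euclidean_space \<Rightarrow> 'b::euclidean_space"
  assumes deriv: "(F has_derivative A) (at x)" and cont: "continuous_on UNIV F"
    and L: "subspace L" and inj: "\<And>l. l \<in> L \<Longrightarrow> adjoint A l = 0 \<Longrightarrow> l = 0"
    and "\<rho> > 0"
  shows "\<exists>s>0. \<forall>t. 0 < t \<and> t \<le> s \<longrightarrow>
    (\<exists>w. norm (w - v) \<le> \<rho> \<and> (\<forall>l\<in>L. l \<bullet> (F (x + t *\<^sub>R w) - F x) = t * (l \<bullet> A v)))"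
proof -
  have linA: "linear A" using deriv by (rule has_derivative_linear)
  obtain B where B: "linear B" and AB: "\<And>y l. l \<in> L \<Longrightarrow> l \<bullet> A (B y) = l \<bullet> y"
    using adjoint_injective_right_inverse[OF linA L inj] by blast
  obtain P where P: "linear P" and PL: "\<And>y. P y \<in> L"
      and Pin: "\<And>y l. l \<in> L \<Longrightarrow> l \<bullet> P y = l \<bullet> y"
    using subspace_projection_exists[OF L] by blast
  obtain M where M: "M > 0" "\<And>z. norm (B z) \<le> M * norm z"
    using linear_bounded_pos[OF B] by blast
  obtain N where N: "N > 0" "\<And>z. norm (P z) \<le> N * norm z"
    using linear_bounded_pos[OF P] by blast
  \<comment> \<open>The constants are fixed backwards: \<open>norm z \<le> \<delta>\<close> forces
    \<open>norm (B z) \<le> \<rho>\<close>; \<open>R\<close> then bounds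
    \<open>norm (v + B z)\<close>; \<open>e\<close> is chosen so that
    \<open>N * e * R = \<delta>\<close>, which makes the ball invariant; \<open>s\<close> keeps
    steps of length up to \<open>t * R\<close> below \<open>d\<close>.\<close>
  define \<delta> where "\<delta> = \<rho> / M"
  have "\<delta> > 0" using \<open>\<rho> > 0\<close> M(1) by (simp add: \<delta>_def)
  define R where "R = norm v + \<rho>"
  have "R > 0" using \<open>\<rho> > 0\<close> by (simp add: R_def add_nonneg_pos)
  define e where "e = \<delta> / (N * R)"
  have "e > 0" using \<open>\<delta> > 0\<close> \<open>R > 0\<close> N(1) by (simp add: e_def)
  then obtain d where d: "d > 0"
      "\<And>y. norm (y - x) < d \<Longrightarrow> norm (F y - F x - A (y - x)) \<le> e * norm (y - x)"
    using deriv unfolding has_derivative_at_alt by blast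
  define s where "s = d / (2 * R)"
  have "s > 0" using d(1) \<open>R > 0\<close> by (simp add: s_def)
  moreover have "\<exists>w. norm (w - v) \<le> \<rho> \<and> (\<forall>l\<in>L. l \<bullet> (F (x + t *\<^sub>R w) - F x) = t * (l \<bullet> A v))"
    if t: "0 < t" "t \<le> s" for t
  proof -
    define w where "w z = v + B z" for z
    \<comment> \<open>A fixed point of \<open>h\<close> solves \<open>P (F (x + t w) - F x - t A v) = 0\<close>, because \<open>P A B = P\<close>.\<close>
    define h where "h z = - (1 / t) *\<^sub>R P (F (x + t *\<^sub>R w z) - F x - A (t *\<^sub>R w z))" for z
    have wv: "norm (w z - v) \<le> \<rho>" if "norm z \<le> \<delta>" for z
    proof -
      have "norm (B z) \<le> M * \<delta>"
        using M that by (meson mult_left_mono less_imp_le order_trans)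
      then show ?thesis using M(1) by (simp add: w_def \<delta>_def)
    qed
    have hz: "norm (h z) \<le> \<delta>" if "norm z \<le> \<delta>" for z
    proof -
      have wR: "norm (w z) \<le> R"
        using wv[OF that] norm_triangle_ineq[of "w z - v" v] by (simp add: R_def)
      have tR: "norm (t *\<^sub>R w z) \<le> t * R" using t wR by simp
      also have "t * R \<le> d / 2" using t(2) \<open>R > 0\<close> by (simp add: s_def field_simps)
      finally have "norm (t *\<^sub>R w z) < d" using d(1) by linarith
      then have "norm (F (x + t *\<^sub>R w z) - F x - A (t *\<^sub>R w z)) \<le> e * norm (t *\<^sub>R w z)"
        using d(2)[of "x + t *\<^sub>R w z"] by simp
      also have "\<dots> \<le> e * (t * R)" using tR \<open>e > 0\<close> by (intro mult_left_mono) auto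
      finally have "norm (P (F (x + t *\<^sub>R w z) - F x - A (t *\<^sub>R w z))) \<le> N * (e * (t * R))"
        using N by (meson mult_left_mono less_imp_le order_trans)
      also have "\<dots> = t * \<delta>" using N(1) \<open>R > 0\<close> by (simp add: e_def)
      finally show ?thesis using t(1) by (simp add: h_def divide_le_eq mult.commute)
    qed
    have contB: "continuous_on U B" and contP: "continuous_on V P" and contA: "continuous_on W A"
      for U V W using B P linA by (simp_all add: linear_continuous_on linear_conv_bounded_linear)
    have "continuous_on (cball 0 \<delta>) h"
      unfolding h_def w_def
      by (intro continuous_intros continuous_on_compose2[OF contP] continuous_on_compose2[OF contA]
          continuous_on_compose2[OF cont] contB) auto
    moreover have "h \<in> cball 0 \<delta> \<rightarrow> cball 0 \<delta>" using hz by auto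
    ultimately obtain z where z: "norm z \<le> \<delta>" "h z = z"
      using brouwer_ball[OF \<open>\<delta> > 0\<close>, of 0 h] by auto
    have "l \<bullet> (F (x + t *\<^sub>R w z) - F x) = t * (l \<bullet> A v)" if "l \<in> L" for l
    proof -
      \<comment> \<open>By the choice of \<open>B\<close>, the term
        \<open>l \<bullet> A (B z)\<close> equals \<open>l \<bullet> z\<close>, so \<open>z\<close>
        cancels from the fixed point equation and the exact identity for \<open>F\<close>
        remains.\<close>
      have "l \<bullet> z = l \<bullet> h z" using z(2) by simp
      also have "\<dots> = - (1 / t) * (l \<bullet> (F (x + t *\<^sub>R w z) - F x) - t * (l \<bullet> A v + l \<bullet> A (B z)))"
        using that by (simp add: h_def Pin w_def linear_cmul[OF linA] linear_add[OF linA]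
            inner_diff_right inner_right_distrib)
      finally show ?thesis using t(1) AB[OF that] by (simp add: field_simps)
    qed
    then show ?thesis using wv[OF z(1)] by blast
  qed
  ultimately show ?thesis by blast
qed

text \<open>The correction is applied with tolerance \<open>1 / (k + 1)\<close>, and the step length
  is capped by the same number, so that both limits hold.\<close>

lemma tangential_sequence:
  fixes F :: "'a::euclidean_space \<Rightarrow> 'b::euclidean_space"
  assumes "(F has_derivative A) (at x)" "continuous_on UNIV F" "subspace L"
    and "\<And>l. l \<in> L \<Longrightarrow> adjoint A l = 0 \<Longrightarrow> l = 0"
  obtains t :: "nat \<Rightarrow> real" and w :: "nat \<Rightarrow> 'a"
  where "\<And>k. t k > 0" "t \<longlonglongrightarrow> 0" "w \<longlonglongrightarrow> v"
    and "\<And>k l. l \<in> L \<Longrightarrow> l \<bullet> (F (x + t k *\<^sub>R w k) - F x) = t k * (l \<bullet> A v)"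
proof -
  have "\<exists>t w. 0 < t \<and> t \<le> inverse (real (Suc k)) \<and> norm (w - v) \<le> inverse (real (Suc k)) \<and>
      (\<forall>l\<in>L. l \<bullet> (F (x + t *\<^sub>R w) - F x) = t * (l \<bullet> A v))" for k
  proof -
    obtain s where "s > 0" and s: "\<And>t. 0 < t \<Longrightarrow> t \<le> s \<Longrightarrow>
        \<exists>w. norm (w - v) \<le> inverse (real (Suc k)) \<and>
          (\<forall>l\<in>L. l \<bullet> (F (x + t *\<^sub>R w) - F x) = t * (l \<bullet> A v))"
      using curve_correction[OF assms, of "inverse (real (Suc k))" v] by auto
    then show ?thesis
      using s[of "min s (inverse (real (Suc k)))"]
      by (intro exI[of _ "min s (inverse (real (Suc k)))"]) auto
  qed
  then obtain t w where tw: "\<And>k. 0 < t k" "\<And>k. t k \<le> inverse (real (Suc k))"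
      "\<And>k. norm (w k - v) \<le> inverse (real (Suc k))"
      "\<And>k l. l \<in> L \<Longrightarrow> l \<bullet> (F (x + t k *\<^sub>R w k) - F x) = t k * (l \<bullet> A v)"
    by metis
  have "t \<longlonglongrightarrow> 0"
    using tw(1,2) by (intro Lim_null_comparison[OF _ LIMSEQ_inverse_real_of_nat])
      (auto simp: less_imp_le)
  moreover have "(\<lambda>k. w k - v) \<longlonglongrightarrow> 0"
    using tw(3) by (intro Lim_null_comparison[OF _ LIMSEQ_inverse_real_of_nat]) auto
  ultimately show thesis
    using that[of t w] tw(1,4) LIM_zero_cancel by blast
qed

text \<open>Frechet differentiability controls difference quotients along varying directions
  \<open>w k\<close>, not only along the fixed ray of \<open>v\<close>; the corrected curves call
  for this form.\<close>

lemma has_derivative_nonneg_sequence: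
  fixes f :: "'a::real_normed_vector \<Rightarrow> real"
  assumes deriv: "(f has_derivative f') (at x)"
    and t: "\<And>k. t k > 0" "t \<longlonglongrightarrow> 0" and w: "w \<longlonglongrightarrow> v"
    and ge: "\<forall>\<^sub>F k in sequentially. f x \<le> f (x + t k *\<^sub>R w k)"
  shows "0 \<le> f' v"
proof -
  interpret bounded_linear f' using deriv by (rule has_derivative_bounded_linear)
  have lim0: "(\<lambda>k. t k *\<^sub>R w k) \<longlonglongrightarrow> 0" using tendsto_scaleR[OF t(2) w] by simp
  have *: "0 \<le> f' v + e * norm v" if "e > 0" for e
  proof -
    obtain d where d: "d > 0"
        "\<And>y. norm (y - x) < d \<Longrightarrow> norm (f y - f x - f' (y - x)) \<le> e * norm (y - x)"
      using deriv \<open>e > 0\<close> unfolding has_derivative_at_alt by blast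
    have "\<forall>\<^sub>F k in sequentially. 0 \<le> f' (w k) + e * norm (w k)"
      using ge order_tendstoD(2)[OF tendsto_norm_zero[OF lim0] d(1)]
    proof eventually_elim
      case (elim k)
      have "\<bar>f (x + t k *\<^sub>R w k) - f x - t k * f' (w k)\<bar> \<le> e * (t k * norm (w k))"
        using d(2)[of "x + t k *\<^sub>R w k"] elim(2) t(1)[of k] by (simp add: scaleR)
      then have "0 \<le> t k * (f' (w k) + e * norm (w k))"
        using elim(1) by (simp add: algebra_simps)
      then show ?case using t(1)[of k] by (simp add: zero_le_mult_iff)
    qed
    moreover have "(\<lambda>k. f' (w k) + e * norm (w k)) \<longlonglongrightarrow> f' v + e * norm v"
      by (intro tendsto_intros tendsto w)
    ultimately show ?thesis by (intro tendsto_lowerbound[of _ _ sequentially]) auto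
  qed
  show ?thesis
  proof (rule field_le_epsilon)
    fix e :: real assume "e > 0"
    \<comment> \<open>Adding 1 keeps the divisor positive also for \<open>v = 0\<close>.\<close>
    have pos: "norm v + 1 > 0" by (simp add: add_nonneg_pos)
    have "e / (norm v + 1) * norm v \<le> e"
      using \<open>e > 0\<close> pos by (simp add: pos_divide_le_eq algebra_simps)
    then show "0 \<le> f' v + e"
      using *[of "e / (norm v + 1)"] \<open>e > 0\<close> pos by simp
  qed
qed

section \<open>Polyhedra near a point and the multiplier of a single branch\<close>

text \<open>\<open>N\<close> consists of the normals of the half spaces active at \<open>y\<close>,
  and on \<open>U\<close> the inactive inequalities stay strict, so inside \<open>U\<close> the
  active ones decide membership. An active inequality at \<open>y + t k *\<^sub>R e k\<close> can be
  divided by \<open>t k\<close>; in the limit its normal is polar to every tangent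
  direction.\<close>

lemma polyhedron_local_normals:
  fixes S :: "'a::euclidean_space set"
  assumes "polyhedron S" "y \<in> S"
  obtains N U where "finite N" "N \<subseteq> frechet_normal_cone S y" "open U" "y \<in> U"
    and "\<And>z. z \<in> U \<Longrightarrow> (\<And>a. a \<in> N \<Longrightarrow> a \<bullet> (z - y) \<le> 0) \<Longrightarrow> z \<in> S"
proof -
  obtain H where H: "finite H" "S = \<Inter>H"
      and half: "\<forall>h\<in>H. \<exists>a b. a \<noteq> 0 \<and> h = {x. a \<bullet> x \<le> b}"
    using assms(1) unfolding polyhedron_def by (elim exE conjE)
  from bchoice[OF half] obtain a where "\<forall>h\<in>H. \<exists>b. a h \<noteq> 0 \<and> h = {x. a h \<bullet> x \<le> b}"
    by (elim exE)
  from bchoice[OF this] obtain b where "\<forall>h\<in>H. a h \<noteq> 0 \<and> h = {x. a h \<bullet> x \<le> b h}"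
    by (elim exE)
  then have mem: "z \<in> h \<longleftrightarrow> a h \<bullet> z \<le> b h" if "h \<in> H" for h z
    using that by auto
  define N where "N = a ` {h \<in> H. a h \<bullet> y = b h}"
  define U where "U = (\<Inter>h\<in>{h \<in> H. a h \<bullet> y < b h}. {x. a h \<bullet> x < b h})"
  show thesis
  proof
    show "finite N" using H(1) by (simp add: N_def)
    show "open U" unfolding U_def using H(1) by (intro open_INT) (auto simp: open_halfspace_lt)
    show "y \<in> U" by (auto simp: U_def)
    show "z \<in> S" if z: "z \<in> U" "\<And>c. c \<in> N \<Longrightarrow> c \<bullet> (z - y) \<le> 0" for z
      unfolding H(2)
    proof
      fix h assume h: "h \<in> H"
      have "a h \<bullet> y \<le> b h" using h mem[OF h] assms(2) H(2) by blast
      then consider "a h \<bullet> y < b h" | "a h \<bullet> y = b h" by linarith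
      then have "a h \<bullet> z \<le> b h"
      proof cases
        case 1
        then show ?thesis using z(1) h by (auto simp: U_def intro: less_imp_le)
      next
        case 2
        then show ?thesis using z(2)[of "a h"] h by (auto simp: N_def inner_diff_right)
      qed
      then show "z \<in> h" using mem[OF h] by blast
    qed
    show "N \<subseteq> frechet_normal_cone S y"
      unfolding frechet_normal_cone_def polar_cone_def
    proof clarify
      fix c d assume "c \<in> N" "d \<in> tangent_cone S y"
      then obtain h where h: "h \<in> H" "c = a h" "a h \<bullet> y = b h" by (auto simp: N_def)
      obtain t :: "nat \<Rightarrow> real" and e where te: "\<And>k. t k > 0" "e \<longlonglongrightarrow> d" "\<And>k. y + t k *\<^sub>R e k \<in> S"
        using \<open>d \<in> tangent_cone S y\<close> unfolding tangent_cone_def by blast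
      have "c \<bullet> e k \<le> 0" for k
      proof -
        have "a h \<bullet> (y + t k *\<^sub>R e k) \<le> b h" using te(3)[of k] H(2) h(1) mem[OF h(1)] by blast
        then show ?thesis using te(1)[of k] h(2,3) by (simp add: inner_right_distrib mult_le_0_iff)
      qed
      moreover have "(\<lambda>k. c \<bullet> e k) \<longlonglongrightarrow> c \<bullet> d" by (intro tendsto_intros te(2))
      ultimately show "c \<bullet> d \<le> 0" by (intro LIMSEQ_le_const2) auto
    qed
  qed
qed

lemma convex_cone_polar_cone: "convex_cone (polar_cone K)"
  unfolding convex_cone_iff polar_cone_def
  by (auto simp: inner_left_distrib intro: add_nonpos_nonpos mult_nonneg_nonpos)

text \<open>For a direction \<open>v\<close> satisfying the linearized active constraints, the
  corrected sequence eventually stays in \<open>S\<close>, so minimality gives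
  \<open>0 \<le> v \<bullet> g\<close>. Farkas' lemma turns this into a multiplier. \<open>L\<close>
  may exceed the span of the normals of \<open>S\<close>, so that one space can serve all
  branches.\<close>

lemma branch_multiplier:
  fixes F :: "'a::euclidean_space \<Rightarrow> 'b::euclidean_space"
  assumes f: "(f has_derivative (\<lambda>h. h \<bullet> g)) (at x)"
    and F: "(F has_derivative A) (at x)" "continuous_on UNIV F"
    and L: "subspace L" "\<And>l. l \<in> L \<Longrightarrow> adjoint A l = 0 \<Longrightarrow> l = 0"
    and S: "polyhedron S" "F x \<in> S" "frechet_normal_cone S (F x) \<subseteq> L"
    and min: "\<epsilon> > 0" "\<And>y. F y \<in> S \<Longrightarrow> y \<in> ball x \<epsilon> \<Longrightarrow> f x \<le> f y"
  shows "\<exists>lam \<in> frechet_normal_cone S (F x). g + adjoint A lam = 0"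
proof -
  have linA: "linear A" using F(1) by (rule has_derivative_linear)
  obtain N U where N: "finite N" "N \<subseteq> frechet_normal_cone S (F x)" and U: "open U" "F x \<in> U"
    and US: "\<And>z. z \<in> U \<Longrightarrow> (\<And>a. a \<in> N \<Longrightarrow> a \<bullet> (z - F x) \<le> 0) \<Longrightarrow> z \<in> S"
    using polyhedron_local_normals[OF S(1,2)] by blast
  have "- g \<in> convex_cone hull (adjoint A ` N)"
  proof (rule farkas_convex_cone_hull)
    show "finite (adjoint A ` N)" using N(1) by simp
    fix v assume v: "\<And>s. s \<in> adjoint A ` N \<Longrightarrow> s \<bullet> v \<le> 0"
    have Av: "a \<bullet> A v \<le> 0" if "a \<in> N" for a
      using v[of "adjoint A a"] that adjoint_works[OF linA, of v a] by (auto simp: inner_commute)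
    obtain t w where t: "\<And>k. t k > 0" "t \<longlonglongrightarrow> 0" and w: "w \<longlonglongrightarrow> v"
      and eq: "\<And>k l. l \<in> L \<Longrightarrow> l \<bullet> (F (x + t k *\<^sub>R w k) - F x) = t k * (l \<bullet> A v)"
      using tangential_sequence[OF F L, of v] by blast
    have lim: "(\<lambda>k. x + t k *\<^sub>R w k) \<longlonglongrightarrow> x"
      using tendsto_add[OF tendsto_const tendsto_scaleR[OF t(2) w], of x] by simp
    have "isCont F x" using F(2) by (simp add: continuous_on_eq_continuous_at)
    then have "(\<lambda>k. F (x + t k *\<^sub>R w k)) \<longlonglongrightarrow> F x" using lim by (rule isCont_tendsto_compose)
    then have "\<forall>\<^sub>F k in sequentially. F (x + t k *\<^sub>R w k) \<in> U" using U by (rule topological_tendstoD)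
    moreover have "\<forall>\<^sub>F k in sequentially. x + t k *\<^sub>R w k \<in> ball x \<epsilon>"
      using lim min(1) by (intro topological_tendstoD) auto
    ultimately have "\<forall>\<^sub>F k in sequentially. f x \<le> f (x + t k *\<^sub>R w k)"
    proof eventually_elim
      case (elim k)
      \<comment> \<open>Since \<open>a\<close> lies in \<open>L\<close>, the correction leaves no
        error term: the sign of \<open>a \<bullet> A v\<close> carries over even when it is
        zero.\<close>
      have "a \<bullet> (F (x + t k *\<^sub>R w k) - F x) \<le> 0" if "a \<in> N" for a
      proof -
        have "a \<in> L" using that N(2) S(3) by blast
        then show ?thesis using Av[OF that] t(1)[of k] by (simp add: eq mult_le_0_iff)
      qed
      then show ?case using US elim min(2) by blast
    qed
    then have "0 \<le> v \<bullet> g"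
      by (rule has_derivative_nonneg_sequence[OF f t w])
    then show "(- g) \<bullet> v \<le> 0" by (simp add: inner_commute)
  qed
  \<comment> \<open>Taking the cone hull commutes with the linear map, so the Farkas combination
    lifts to a vector in the cone generated by \<open>N\<close>.\<close>
  also have "\<dots> = adjoint A ` (convex_cone hull N)"
    by (rule convex_cone_hull_linear_image[OF adjoint_linear[OF linA]])
  finally obtain lam where lam: "lam \<in> convex_cone hull N" "- g = adjoint A lam" by blast
  have "convex_cone hull N \<subseteq> frechet_normal_cone S (F x)"
    using N(2) unfolding frechet_normal_cone_def
    by (rule hull_minimal) (rule convex_cone_polar_cone)
  with lam show ?thesis by (metis add.right_inverse subsetD)
qed

section \<open>Minkowski sums of subspaces, and the gradient\<close>

lemma subspace_set_sum:
  fixes S :: "'i \<Rightarrow> 'a::real_vector set"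
  assumes "finite I" "\<And>i. i \<in> I \<Longrightarrow> subspace (S i)"
  shows "subspace (\<Sum>i\<in>I. S i)"
  using assms
proof (induction I)
  case (insert i I)
  have "S i + (\<Sum>i\<in>I. S i) = {x + y |x y. x \<in> S i \<and> y \<in> (\<Sum>i\<in>I. S i)}"
    by (auto simp: set_plus_def)
  then show ?case
    using insert subspace_sums[of "S i" "\<Sum>i\<in>I. S i"] by simp
qed (simp add: set_zero)

text \<open>A vector of one summand is completed by zeros from the others; this places every active
  normal cone in the space of the LICQ condition.\<close>

lemma subset_set_sum:
  fixes S :: "'i \<Rightarrow> 'a::real_vector set"
  assumes "finite I" "i \<in> I" "\<And>j. j \<in> I \<Longrightarrow> 0 \<in> S j"
  shows "S i \<subseteq> (\<Sum>j\<in>I. S j)"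
proof
  fix x assume "x \<in> S i"
  have "x = (\<Sum>j\<in>I. if j = i then x else 0)" using assms(1,2) by simp
  then show "x \<in> (\<Sum>j\<in>I. S j)"
    unfolding set_sum_alt[OF assms(1)] using assms(3) \<open>x \<in> S i\<close>
    by (intro CollectI exI[of _ "\<lambda>j. if j = i then x else 0"]) auto
qed

text \<open>The definite description in \<open>gradient\<close> requires existence and uniqueness:
  \<open>adjoint f' 1\<close> is the Riesz representative of \<open>f'\<close>, and inner products
  with all vectors determine it.\<close>

lemma GDERIV_gradient:
  fixes f :: "'a::euclidean_space \<Rightarrow> real"
  assumes "f differentiable (at x)"
  shows "GDERIV f x :> gradient f x"
proof -
  obtain f' where f': "(f has_derivative f') (at x)"
    using assms by (auto simp: differentiable_def)
  have "f' h = h \<bullet> adjoint f' 1" for h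
    using adjoint_works[OF has_derivative_linear[OF f'], of h 1] by simp
  then have "GDERIV f x :> adjoint f' 1"
    unfolding gderiv_def by (intro has_derivative_eq_rhs[OF f'] ext)
  moreover have "g = adjoint f' 1" if "GDERIV f x :> g" for g
  proof -
    have "(\<lambda>h. h \<bullet> g) = (\<lambda>h. h \<bullet> adjoint f' 1)"
      using that \<open>GDERIV f x :> adjoint f' 1\<close> unfolding gderiv_def
      by (rule has_derivative_unique)
    then have "h \<bullet> g = h \<bullet> adjoint f' 1" for h by (rule fun_cong)
    then show ?thesis using vector_eq_ldot by blast
  qed
  ultimately show ?thesis unfolding gradient_def by (rule theI)
qed

lemma twice_continuously_differentiable_imp_differentiable:
  assumes "twice_continuously_differentiable f"
  shows "f differentiable (at x)"
  using assms unfolding twice_continuously_differentiable_def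
  by (elim exE conjE) (rule differentiableI, erule spec)

section \<open>One multiplier common to all active branches\<close>

theorem theorem3p8:
  fixes f :: "real^'n \<Rightarrow> real"
    and F :: "real^'n \<Rightarrow> real^'m"
    and D :: "nat \<Rightarrow> (real^'m) set"
    and r :: nat
    and xbar :: "real^'n"
  assumes "twice_continuously_differentiable f"
    and "twice_continuously_differentiable F"
    and "\<And>i. i \<in> {1..r} \<Longrightarrow> polyhedron (D i)"
    and "locally_optimal f (feasible_set F D r) xbar"
    and "MPDC_LICQ F D r xbar"
  shows "\<exists>!lam::real^'m.
           0 = gradient f xbar + transpose (jacobian F (at xbar)) *v lam \<and>
           lam \<in> (\<Inter>i\<in>active_indices F D r xbar. frechet_normal_cone (D i) (F xbar))"
proof -
  define g where "g = gradient f xbar"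
  define A where "A h = jacobian F (at xbar) *v h" for h
  define I where "I = active_indices F D r xbar"
  define N where "N i = frechet_normal_cone (D i) (F xbar)" for i
  define L where "L = (\<Sum>i\<in>I. span (N i))"
  have f: "(f has_derivative (\<lambda>h. h \<bullet> g)) (at xbar)"
    using GDERIV_gradient[OF twice_continuously_differentiable_imp_differentiable[OF assms(1)]]
    unfolding g_def gderiv_def .
  have diffF: "F differentiable (at x)" for x
    using assms(2) by (rule twice_continuously_differentiable_imp_differentiable)
  have F: "(F has_derivative A) (at xbar)"
    using diffF[of xbar] unfolding jacobian_works A_def .
  have contF: "continuous_on UNIV F"
    using diffF by (simp add: continuous_on_eq_continuous_at differentiable_imp_continuous_within)
  have adj: "adjoint A = (\<lambda>lam. transpose (jacobian F (at xbar)) *v lam)"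
    unfolding A_def by (rule adjoint_matrix)
  have "finite I" by (simp add: I_def active_indices_def)
  \<comment> \<open>Feasibility supplies an active index. It ensures that the intersection of normal
    cones is taken over a nonempty family and hence lies in \<open>L\<close>.\<close>
  obtain i0 where "i0 \<in> I"
    using assms(4) by (auto simp: locally_optimal_def feasible_set_def I_def active_indices_def)
  have L: "subspace L"
    unfolding L_def using \<open>finite I\<close> by (intro subspace_set_sum) auto
  have NL: "N i \<subseteq> L" if "i \<in> I" for i
  proof -
    have "span (N i) \<subseteq> L"
      unfolding L_def using \<open>finite I\<close> that by (rule subset_set_sum) (rule span_zero)
    then show ?thesis using span_superset by (rule order_trans[rotated])
  qed
  \<comment> \<open>This is LICQ, with the transposed Jacobian read as
    \<open>adjoint A\<close>.\<close>
  have inj: "l = 0" if "l \<in> L" "adjoint A l = 0" for l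
    using assms(5)[unfolded MPDC_LICQ_def, rule_format, of l] that
    unfolding adj L_def I_def N_def by simp
  \<comment> \<open>Formulated on \<open>L\<close>, so that it compares multipliers of different
    branches as well as two candidates for the common one.\<close>
  have unique: "lam = mu" if "lam \<in> L" "mu \<in> L" "g + adjoint A lam = 0" "g + adjoint A mu = 0"
    for lam mu
  proof -
    have "adjoint A (lam - mu) = adjoint A lam - adjoint A mu"
      by (rule linear_diff[OF adjoint_linear[OF has_derivative_linear[OF F]]])
    then have "adjoint A (lam - mu) = 0" using that(3,4) by (simp add: add_eq_0_iff)
    then have "lam - mu = 0" by (rule inj[OF subspace_diff[OF L that(1,2)]])
    then show ?thesis by simp
  qed
  obtain \<epsilon> where \<epsilon>: "\<epsilon> > 0" "\<And>y. y \<in> feasible_set F D r \<Longrightarrow> y \<in> ball xbar \<epsilon> \<Longrightarrow> f xbar \<le> f y"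
    using assms(4) unfolding locally_optimal_def by blast
  have ex: "\<exists>lam\<in>N i. g + adjoint A lam = 0" if "i \<in> I" for i
    unfolding N_def
  proof (rule branch_multiplier[OF f F contF L inj _ _ _ \<epsilon>(1)])
    have i: "i \<in> {1..r}" "F xbar \<in> D i" using that by (auto simp: I_def active_indices_def)
    show "polyhedron (D i)" "F xbar \<in> D i" using assms(3) i by auto
    show "frechet_normal_cone (D i) (F xbar) \<subseteq> L" using NL[OF that] by (simp add: N_def)
    \<comment> \<open>Each active \<open>D i\<close> is part of the union, so local optimality on
      the whole feasible set passes to the branch.\<close>
    show "f xbar \<le> f y" if "F y \<in> D i" "y \<in> ball xbar \<epsilon>" for y
      using that i by (intro \<epsilon>(2)) (auto simp: feasible_set_def)
  qed
  obtain lam where lam: "lam \<in> N i0" "g + adjoint A lam = 0" using ex[OF \<open>i0 \<in> I\<close>] by blast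
  \<comment> \<open>The multiplier found for \<open>i0\<close> coincides with that of every other
    active branch and inherits its normality.\<close>
  have mem: "lam \<in> N i" if i: "i \<in> I" for i
  proof -
    obtain mu where mu: "mu \<in> N i" "g + adjoint A mu = 0" using ex[OF i] by blast
    have "mu = lam" 
      using subsetD[OF NL[OF i] mu(1)] subsetD[OF NL[OF \<open>i0 \<in> I\<close>] lam(1)] mu(2) lam(2)
      by (rule unique)
    then show ?thesis using mu(1) by simp
  qed
  have "\<exists>!lam. 0 = g + adjoint A lam \<and> lam \<in> (\<Inter>i\<in>I. N i)"
  proof (rule ex1I)
    show "0 = g + adjoint A lam \<and> lam \<in> (\<Inter>i\<in>I. N i)"
      using lam(2) mem by simp
    fix mu assume mu: "0 = g + adjoint A mu \<and> mu \<in> (\<Inter>i\<in>I. N i)"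
    then have "mu \<in> N i0" using \<open>i0 \<in> I\<close> by blast
    then show "mu = lam"
      using subsetD[OF NL[OF \<open>i0 \<in> I\<close>]] lam mu by (intro unique) simp_all
  qed
  then show ?thesis unfolding g_def adj I_def N_def .
qed

end
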